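(* For every positive integer $n$, \[ D(n)\ \ge\ \max\{\ell_1(n),\ell_2(n),\ell_3(n)\}, \] where: $\ell_1(n)=T_k+(r-2)(k+2)+2$ if $n=T_k+r$ with integers $k\ge 1$, $2\le r\le k+1$, and $\ell_1(n)=-1$ if $n$ has no such representation; $\ell_2(n)=T_k+k(k-r-2)$ if $n=T_k+r$ with integers $k\ge 2$, $0\le r\le k-2$, and $\ell_2(n)=-1$ otherwise; $\ell_3(n)=T_{2r}+2r(r-1)$ if $n=T_{2r}+r$ for some integer $r\ge1$, and $\ell_3(n)=-1$ otherwise.
   Context: $T_j=j(j+1)/2$; the representations used in defining $\ell_1,\ell_2,\ell_3$ are unique when they exist. A mancala configuration is a map $\lambda:\mathbb N^*\to\mathbb N$ whose support $\{i:\lambda_i>0\}$ equals $\{1,\dots,\ell\}$ for some $\ell\ge0$; its mass is $\sum_i\lambda_i$ and $\Lambda_n$ denotes the set of those of mass $n$. The move $\Phi$: $\mu=\Phi(\lambda)$ with $\mu_i=\lambda_{i+1}+1$ for $1\le i\le\lambda_1$, $\mu_i=\lambda_{i+1}$ for $i>\lambda_1$. Componentwise order; $\lambda<\mu$ means $\lambda\le\mu$, $\lambda\ne\mu$. Marching group $M^k$: $M^k_i=k-i+1$ for $i\le k$, $0$ otherwise. An augmented marching group is a mancala configuration $\lambda$ with $M^k\le\lambda<M^{k+1}$ for some $k\ge0$. The depth of $\lambda$ is the least $t\ge0$ such that $\Phi^t(\lambda)$ is an augmented marching group; $D(n)$ is the maximal depth over $\Lambda_n$. *)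

theory Defs
  imports Main
begin

definition T :: "nat \<Rightarrow> nat" where
  "T j = j * (j + 1) div 2"

(* Indices range over the positive integers; functions are total on nat, and the
   support condition below forces a configuration to vanish at the unused index 0. *)
definition mancala_config :: "(nat \<Rightarrow> nat) \<Rightarrow> bool" where
  "mancala_config c \<longleftrightarrow> (\<exists>l. {i. c i > 0} = {1..l})"

definition mass :: "(nat \<Rightarrow> nat) \<Rightarrow> nat" where
  "mass c = (\<Sum>i | c i > 0. c i)"

definition configs :: "nat \<Rightarrow> (nat \<Rightarrow> nat) set" where
  "configs n = {c. mancala_config c \<and> mass c = n}"

definition move :: "(nat \<Rightarrow> nat) \<Rightarrow> (nat \<Rightarrow> nat)" where
  "move c = (\<lambda>i. if i = 0 then 0
                 else if i \<le> c 1 then c (i + 1) + 1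
                 else c (i + 1))"

definition marching_group :: "nat \<Rightarrow> (nat \<Rightarrow> nat)" where
  "marching_group k = (\<lambda>i. if 1 \<le> i \<and> i \<le> k then k - i + 1 else 0)"

(* The orders are the library's pointwise order on functions, for which
   f < g holds iff f \<le> g and f \<noteq> g. *)
definition augmented_marching_group :: "(nat \<Rightarrow> nat) \<Rightarrow> bool" where
  "augmented_marching_group c \<longleftrightarrow>
     mancala_config c \<and> (\<exists>k. marching_group k \<le> c \<and> c < marching_group (k + 1))"

definition depth :: "(nat \<Rightarrow> nat) \<Rightarrow> nat" where
  "depth c = (LEAST t. augmented_marching_group ((move ^^ t) c))"

definition D :: "nat \<Rightarrow> nat" where
  "D n = Max (depth ` configs n)"

(* In each of the next three definitions the representation of n is unique if it
   exists, so the description operator picks out a well-defined value. *)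
definition ell1 :: "nat \<Rightarrow> int" where
  "ell1 n =
     (if \<exists>k r. k \<ge> 1 \<and> 2 \<le> r \<and> r \<le> k + 1 \<and> n = T k + r
      then THE v. \<exists>k r. k \<ge> 1 \<and> 2 \<le> r \<and> r \<le> k + 1 \<and> n = T k + r \<and>
             v = int (T k) + (int r - 2) * (int k + 2) + 2
      else -1)"

definition ell2 :: "nat \<Rightarrow> int" where
  "ell2 n =
     (if \<exists>k r. k \<ge> 2 \<and> r \<le> k - 2 \<and> n = T k + r
      then THE v. \<exists>k r. k \<ge> 2 \<and> r \<le> k - 2 \<and> n = T k + r \<and>
             v = int (T k) + int k * (int k - int r - 2)
      else -1)"

definition ell3 :: "nat \<Rightarrow> int" where
  "ell3 n =
     (if \<exists>r. r \<ge> 1 \<and> n = T (2 * r) + r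
      then THE v. \<exists>r. r \<ge> 1 \<and> n = T (2 * r) + r \<and>
             v = int (T (2 * r)) + 2 * int r * (int r - 1)
      else -1)"

end

theory Submission
  imports Defs
begin

text \<open>
  Cut a configuration close to \<open>M\<^sup>k\<close> into staircase levels, where the \<open>m\<close>-th level consists of
  the \<open>m\<close> places by which \<open>M\<^sup>m\<close> exceeds the preceding marching group. As long as no seed lies
  above an empty place of a lower level, a move rotates each level cyclically, the \<open>m\<close>-th one
  with period \<open>m\<close>.
  Starting with \<open>T\<^sub>j\<close> singletons followed by a tail, \<open>T\<^sub>j\<close> moves pile a marching group \<open>M\<^sup>j\<close>
  below the tail. The tails are chosen such that consecutive levels, rotating with periods that
  differ by one, need as long as possible until a seed of a high level meets a gap of a lower one.
  Since augmented marching groups are preserved by moves, only the last moment before that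
  collision has to be examined.
\<close>

section \<open>Triangular numbers and uniqueness of the representations\<close>

lemma T_Suc: "T (Suc j) = T j + Suc j"
proof -
  have "Suc j * (Suc j + 1) = j * (j + 1) + 2 * Suc j" by (simp add: algebra_simps)
  then show ?thesis unfolding T_def by presburger
qed

lemma T_mono: "i \<le> j \<Longrightarrow> T i \<le> T j"
  by (rule lift_Suc_mono_le[of T]) (simp_all add: T_Suc)

lemma T_rep_le:
  assumes "T k + r = T k' + r'" "r \<le> k"
  shows "k' \<le> k"
proof (rule ccontr)
  assume "\<not> k' \<le> k"
  then have "T (Suc k) \<le> T k'" by (intro T_mono) simp
  with assms show False by (simp add: T_Suc)
qed

lemma T_rep_unique:
  assumes "T k + r = T k' + r'" "r \<le> k" "r' \<le> k'"
  shows "k = k'" "r = r'"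
proof -
  show "k = k'"
    using T_rep_le[OF assms(1,2)] T_rep_le[OF assms(1)[symmetric] assms(3)] by simp
  with assms(1) show "r = r'" by simp
qed

section \<open>Augmented marching groups, their persistence, and depth\<close>

lemma marching_group_apply: "marching_group k i = (if i = 0 then 0 else Suc k - i)"
  by (auto simp: marching_group_def)

text \<open>The sandwich alone forces a contiguous support, and the excluded upper end
  \<open>marching_group (Suc k)\<close> is itself augmented, with the next index as witness.\<close>

lemma augmented_iff:
  "augmented_marching_group c \<longleftrightarrow> (\<exists>k. marching_group k \<le> c \<and> c \<le> marching_group (Suc k))"
proof
  assume "augmented_marching_group c"
  then show "\<exists>k. marching_group k \<le> c \<and> c \<le> marching_group (Suc k)"
    unfolding augmented_marching_group_def by (metis Suc_eq_plus1 less_imp_le)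
next
  assume "\<exists>k. marching_group k \<le> c \<and> c \<le> marching_group (Suc k)"
  then obtain k where le: "marching_group k \<le> c" "c \<le> marching_group (Suc k)" by blast
  have lo: "Suc k - i \<le> c i" if "i \<noteq> 0" for i
    using le_funD[OF le(1), of i] that by (simp only: marching_group_apply if_False)
  have up: "c i \<le> (if i = 0 then 0 else Suc (Suc k) - i)" for i
    using le(2) by (simp only: le_fun_def marching_group_apply)
  have "{i. c i > 0} = {1..(if c (Suc k) > 0 then Suc k else k)}"
  proof (intro set_eqI)
    fix i
    have "c i > 0" if "i \<noteq> 0" "i \<le> k" using lo[OF that(1)] that(2) by linarith
    moreover have "i \<noteq> 0 \<and> i \<le> Suc k" if "c i > 0"
      using up[of i] that by (auto split: if_splits)
    ultimately show "i \<in> {i. c i > 0} \<longleftrightarrow> i \<in> {1..(if c (Suc k) > 0 then Suc k else k)}"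
      by (cases "i = Suc k") (auto simp: le_Suc_eq)
  qed
  then have mc: "mancala_config c" unfolding mancala_config_def by blast
  show "augmented_marching_group c"
  proof (cases "c = marching_group (Suc k)")
    case True
    have "marching_group (Suc k) \<le> marching_group (Suc (Suc k))"
      by (auto simp: le_fun_def marching_group_apply)
    moreover have "marching_group (Suc k) (Suc (Suc k)) \<noteq> marching_group (Suc (Suc k)) (Suc (Suc k))"
      by (simp add: marching_group_apply)
    ultimately have "marching_group (Suc k) < marching_group (Suc k + 1)"
      by (metis Suc_eq_plus1 order_le_less)
    with mc True show ?thesis unfolding augmented_marching_group_def by blast
  next
    case False
    with mc le show ?thesis unfolding augmented_marching_group_def
      by (metis Suc_eq_plus1 order_le_less)
  qed
qed

text \<open>The first pile holds \<open>k\<close> or \<open>k + 1\<close> seeds. So after the shift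
  at least the first \<open>k\<close> and at most the first \<open>k + 1\<close> places gain a seed,
  which restores both bounds.\<close>

lemma augmented_move:
  assumes "augmented_marching_group c"
  shows "augmented_marching_group (move c)"
proof -
  obtain k where le: "marching_group k \<le> c" "c \<le> marching_group (Suc k)"
    using assms by (auto simp: augmented_iff)
  have lo: "k - i \<le> c (i + 1)" and up: "c (i + 1) \<le> Suc k - i" for i
    using le by (auto simp: le_fun_def marching_group_apply dest!: spec[of _ "i + 1"])
  have c1: "c 1 = k \<or> c 1 = Suc k" using lo[of 0] up[of 0] by auto
  have "marching_group k i \<le> move c i \<and> move c i \<le> marching_group (Suc k) i" for i
    using lo[of i] up[of i] c1 unfolding move_def marching_group_apply by auto
  then show ?thesis unfolding augmented_iff le_fun_def by blast
qed

lemma augmented_move_funpow: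
  assumes "augmented_marching_group ((move ^^ s) c)" "s \<le> t"
  shows "augmented_marching_group ((move ^^ t) c)"
  using assms(2,1) by (induction t rule: dec_induct) (auto intro: augmented_move)

text \<open>Between two consecutive marching groups the first pile is at least \<open>k\<close> and
  every place beyond \<open>k + 1\<close> is empty. This test at one place certifies the last moment
  before the collision in both constructions.\<close>

lemma not_augmented:
  assumes "c (c 1 + 2) > 0"
  shows "\<not> augmented_marching_group c"
proof
  assume "augmented_marching_group c"
  then obtain k where le: "marching_group k \<le> c" "c \<le> marching_group (Suc k)"
    by (auto simp: augmented_iff)
  have "k \<le> c 1" "c (c 1 + 2) \<le> k - c 1"
    using le_funD[OF le(1), of 1] le_funD[OF le(2), of "c 1 + 2"]
    by (simp_all add: marching_group_apply)
  with assms show False by simp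
qed

lemma depth_eqI:
  assumes "\<not> augmented_marching_group ((move ^^ v) c)"
    and "augmented_marching_group ((move ^^ Suc v) c)"
  shows "depth c = Suc v"
  unfolding depth_def
proof (rule Least_equality)
  fix t assume "augmented_marching_group ((move ^^ t) c)"
  with assms(1) augmented_move_funpow show "Suc v \<le> t" by (metis not_less_eq_eq)
qed (rule assms(2))

text \<open>Needed for \<open>Max\<close> in \<open>D\<close>: the mass bounds the number of piles
  and the size of each pile.\<close>

lemma finite_configs: "finite (configs n)"
proof (rule finite_subset)
  show "configs n \<subseteq> {c. \<forall>i. (i \<in> {..n} \<longrightarrow> c i \<in> {..n}) \<and> (i \<notin> {..n} \<longrightarrow> c i = 0)}"
  proof (intro subsetI CollectI allI)
    fix c i assume c: "c \<in> configs n"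
    obtain l where l: "{i. c i > 0} = {1..l}"
      using c by (auto simp: configs_def mancala_config_def)
    have n: "(\<Sum>i\<in>{1..l}. c i) = n" using c l by (simp add: configs_def mass_def)
    have pos: "c i > 0 \<longleftrightarrow> i \<in> {1..l}" for i using l by blast
    have "(\<Sum>i\<in>{1..l}. 1) \<le> (\<Sum>i\<in>{1..l}. c i)" using pos by (intro sum_mono) (simp add: Suc_le_eq)
    then have "l \<le> n" using n by simp
    moreover have "c i \<le> n" if "i \<in> {1..l}"
      using member_le_sum[OF that, of c] n by simp
    ultimately show "(i \<in> {..n} \<longrightarrow> c i \<in> {..n}) \<and> (i \<notin> {..n} \<longrightarrow> c i = 0)"
      using pos[of i] by (cases "i \<in> {1..l}") auto
  qed
  show "finite {c. \<forall>i. (i \<in> {..n} \<longrightarrow> c i \<in> {..n}) \<and> (i \<notin> {..n} \<longrightarrow> c i = (0::nat))}"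
    by (rule finite_set_of_finite_funs) auto
qed

lemma depth_le_D: "c \<in> configs n \<Longrightarrow> depth c \<le> D n"
  unfolding D_def by (intro Max_ge finite_imageI finite_configs imageI)

section \<open>Building a marching group from singletons\<close>

text \<open>Each of these moves empties a first pile of exactly \<open>Suc j\<close> seeds; it
  restores the marching group and leaves one extra seed at place \<open>Suc j\<close>. The
  \<open>of_bool\<close> term records these extra seeds, which fill a new level while the ones of
  \<open>f\<close> run out at the front.\<close>

lemma move_marching_ones:
  assumes "s \<le> Suc j" "\<And>i. 1 \<le> i \<Longrightarrow> i \<le> Suc j \<Longrightarrow> f i = 1"
  shows "(move ^^ s) (\<lambda>i. if i = 0 then 0 else Suc j - i + f i) =
    (\<lambda>i. if i = 0 then 0
         else Suc j - i + f (i + s) + of_bool (Suc j < i + s \<and> i \<le> Suc j))"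
  using assms(1)
proof (induction s)
  case (Suc s)
  have "f (Suc s) = 1" using assms(2) Suc.prems by simp
  then show ?case using Suc by (auto simp: move_def fun_eq_iff)
qed (auto simp: fun_eq_iff)

lemma move_ones:
  "(move ^^ T j) (\<lambda>i. if i = 0 then 0 else if i \<le> T j then 1 else f (i - T j)) =
    (\<lambda>i. if i = 0 then 0 else Suc j - i + f i)"
proof (induction j arbitrary: f)
  case 0
  show ?case by (auto simp: T_def fun_eq_iff)
next
  case (Suc j)
  \<comment> \<open>The last \<open>Suc j\<close> ones count as the start of the tail, hence the
    induction over arbitrary \<open>f\<close>.\<close>
  let ?f = "\<lambda>i. if i \<le> Suc j then 1 else f (i - Suc j)"
  have "(\<lambda>i. if i = 0 then 0 else if i \<le> T (Suc j) then 1 else f (i - T (Suc j))) =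
      (\<lambda>i. if i = 0 then 0 else if i \<le> T j then 1 else ?f (i - T j))"
    by (auto simp: T_Suc fun_eq_iff)
  then have "(move ^^ T (Suc j))
        (\<lambda>i. if i = 0 then 0 else if i \<le> T (Suc j) then 1 else f (i - T (Suc j))) =
      (move ^^ Suc j) ((move ^^ T j)
        (\<lambda>i. if i = 0 then 0 else if i \<le> T j then 1 else ?f (i - T j)))"
    by (simp only: T_Suc add.commute[of "T j"] funpow_add o_apply)
  also have "\<dots> = (move ^^ Suc j) (\<lambda>i. if i = 0 then 0 else Suc j - i + ?f i)"
    by (simp only: Suc.IH[of ?f])
  also have "\<dots> = (\<lambda>i. if i = 0 then 0 else Suc (Suc j) - i + f i)"
    by (subst move_marching_ones) (auto simp: fun_eq_iff)
  finally show ?case .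
qed

text \<open>The moves that build the marching group from \<open>T j\<close> singletons are added to
  the depth, so only the evolution from \<open>c\<close> onwards remains to be studied. The tail has
  three rows, and the longest one, \<open>p\<close>, determines the support.\<close>

lemma depth_bound:
  fixes p q u j s :: nat
  defines "c \<equiv> \<lambda>i. if i = 0 then 0
    else Suc j - i + (of_bool (i \<le> p) + of_bool (i \<le> q) + of_bool (i \<le> u))"
  assumes "q \<le> p" "u \<le> p"
    and "\<not> augmented_marching_group ((move ^^ s) c)"
    and "augmented_marching_group ((move ^^ Suc s) c)"
  shows "T j + Suc s \<le> D (T j + p + q + u)"
proof -
  let ?f = "\<lambda>i. of_bool (i \<le> p) + of_bool (i \<le> q) + of_bool (i \<le> u) :: nat"
  define b where "b = (\<lambda>i. if i = 0 then 0 else if i \<le> T j then 1 else ?f (i - T j))"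
  have supp: "{i. b i > 0} = {1..T j + p}"
    using assms(2,3) by (auto simp: b_def split: if_splits)
  have "mass b = (\<Sum>i\<in>{1..T j + p}. b i)" unfolding mass_def supp ..
  also have "\<dots> = (\<Sum>i\<in>{1..T j + p}. 1 + of_bool (i \<in> {T j + 1..T j + q}) + of_bool (i \<in> {T j + 1..T j + u}))"
    by (intro sum.cong) (auto simp: b_def)
  also have "\<dots> = T j + p + q + u"
  proof -
    have seg: "(\<Sum>i\<in>{1..T j + p}. of_bool (i \<in> {T j + 1..T j + x})) = x" if "x \<le> p" for x
    proof -
      have "{1..T j + p} \<inter> {T j + 1..T j + x} = {T j + 1..T j + x}" using that by auto
      then show ?thesis by (simp only: sum_of_bool_eq finite_atLeastAtMost Collect_mem_eq) simp
    qed
    show ?thesis by (simp only: sum.distrib seg[OF assms(2)] seg[OF assms(3)]) simp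
  qed
  finally have "b \<in> configs (T j + p + q + u)"
    using supp by (auto simp: configs_def mancala_config_def)
  moreover have "(move ^^ (t + T j)) b = (move ^^ t) c" for t
    unfolding funpow_add o_apply b_def c_def by (simp only: move_ones[of j ?f])
  then have "depth b = Suc (s + T j)"
    using assms(4,5) by (intro depth_eqI) (simp_all flip: add_Suc)
  ultimately show ?thesis using depth_le_D by fastforce
qed

section \<open>Rotation of three staircase levels\<close>

text \<open>
  Three consecutive staircase levels with \<open>k\<close>, \<open>k + 1\<close> and \<open>k + 2\<close> places on top of
  \<open>marching_group (k - 1)\<close>; place \<open>i\<close> of a level is occupied after \<open>s\<close> moves iff the predicate of that
  level holds at \<open>s + i\<close>.
\<close>

definition levels ::
  "nat \<Rightarrow> (nat \<Rightarrow> bool) \<Rightarrow> (nat \<Rightarrow> bool) \<Rightarrow> (nat \<Rightarrow> bool) \<Rightarrow> nat \<Rightarrow> nat \<Rightarrow> nat" where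
  "levels k P Q R s = (\<lambda>i. if i = 0 then 0
     else k - i + of_bool (i \<le> k \<and> P (s + i)) + of_bool (i \<le> k + 1 \<and> Q (s + i))
       + of_bool (i \<le> k + 2 \<and> R (s + i)))"

text \<open>By the nesting at place 1, the first pile reaches place \<open>k\<close>,
  \<open>k + 1\<close> or \<open>k + 2\<close> exactly if \<open>P\<close>, \<open>Q\<close> or
  \<open>R\<close>, respectively, holds there. So every level gets its front seed back at its last
  place.\<close>

lemma move_levels:
  assumes "k \<ge> 1" "\<And>t. P (t + k) = P t" "\<And>t. Q (t + (k + 1)) = Q t" "\<And>t. R (t + (k + 2)) = R t"
    and "R (Suc s) \<Longrightarrow> Q (Suc s)" "Q (Suc s) \<Longrightarrow> P (Suc s)"
  shows "move (levels k P Q R s) = levels k P Q R (Suc s)"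
proof
  fix i
  have per: "P (Suc s + k) = P (Suc s)" "Q (Suc s + (k + 1)) = Q (Suc s)"
    "R (Suc s + (k + 2)) = R (Suc s)"
    using assms(2,3,4) by blast+
  consider "i = 0" | "1 \<le> i" "i < k" | "1 \<le> i" "i = k" | "i = k + 1" | "i = k + 2" | "i > k + 2"
    by linarith
  then show "move (levels k P Q R s) i = levels k P Q R (Suc s) i"
    using assms(1,5,6) per by cases (auto simp: move_def levels_def)
qed

lemma move_funpow_levels:
  assumes "k \<ge> 1" "\<And>t. P (t + k) = P t" "\<And>t. Q (t + (k + 1)) = Q t" "\<And>t. R (t + (k + 2)) = R t"
    and "\<And>t. 1 \<le> t \<Longrightarrow> t \<le> s \<Longrightarrow> R t \<Longrightarrow> Q t" "\<And>t. 1 \<le> t \<Longrightarrow> t \<le> s \<Longrightarrow> Q t \<Longrightarrow> P t"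
  shows "(move ^^ s) (levels k P Q R 0) = levels k P Q R s"
  using assms(5,6)
proof (induction s)
  case (Suc s)
  then show ?case using move_levels[of k P Q R s] assms(1-4) by simp
qed simp

text \<open>Over \<open>marching_group (k - 1)\<close>, each place up to \<open>k\<close> needs one
  or two extra seeds, place \<open>k + 1\<close> allows at most one, and place \<open>k + 2\<close>
  none. A gap in \<open>P\<close> is harmless below a seed of \<open>Q\<close>.\<close>

lemma levels_augmented:
  assumes "\<And>i. 1 \<le> i \<Longrightarrow> i \<le> k \<Longrightarrow> (P (s + i) \<or> Q (s + i)) \<and> \<not> R (s + i)"
    and "\<not> (Q (s + (k + 1)) \<and> R (s + (k + 1)))" "\<not> R (s + (k + 2))"
  shows "augmented_marching_group (levels k P Q R s)"
proof -
  have "marching_group k i \<le> levels k P Q R s i \<and> levels k P Q R s i \<le> marching_group (Suc k) i"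
    for i
  proof -
    consider "i = 0" | "1 \<le> i" "i \<le> k" | "i = k + 1" | "i = k + 2" | "i > k + 2"
      by linarith
    then show ?thesis
      using assms(1)[of i] assms(2,3) by cases (auto simp: levels_def marching_group_apply)
  qed
  then show ?thesis unfolding augmented_iff le_fun_def by blast
qed

section \<open>Two families of slow configurations\<close>

text \<open>Level \<open>k\<close> is full, level \<open>k + 1\<close> has its first
  \<open>e + 1\<close> places filled, and level \<open>k + 2\<close> has a single seed. Since
  \<open>k + 2\<close> is 1 modulo \<open>k + 1\<close>, each return of this seed to the front meets
  the next residue of \<open>Q\<close>, so \<open>e + 1\<close> visits are safe.\<close>

lemma D_ge_high_seed:
  assumes "k \<ge> 1" "e + 1 \<le> k"
  shows "T k + e * (k + 2) + 2 \<le> D (T k + (e + 2))"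
proof -
  define Q where "Q = (\<lambda>t. t mod (k + 1) \<in> {1..e + 1})"
  define R where "R = (\<lambda>t. t mod (k + 2) = 1)"
  let ?L = "levels k (\<lambda>_. True) Q R" and ?s = "e * (k + 2) + 1"
  have perQ: "Q (t + (k + 1)) = Q t" for t unfolding Q_def by (simp only: mod_add_self2)
  have perR: "R (t + (k + 2)) = R t" for t unfolding R_def by (simp only: mod_add_self2)
  have R_shift: "R (x + j * (k + 2)) \<longleftrightarrow> R x" for j x unfolding R_def by (simp only: mod_mult_self1)
  have Q_shift: "Q (x + j + j * (k + 1)) \<longleftrightarrow> Q (x + j)" for j x
    unfolding Q_def by (simp only: mod_mult_self1)
  have stable: "Q t" if "t \<le> e * (k + 2) + 2" "R t" for t
  proof -
    define j where "j = t div (k + 2)"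
    have t: "t = 1 + j * (k + 2)"
      using that(2) div_mult_mod_eq[of t "k + 2"] by (simp add: R_def j_def)
    then have "j * (k + 2) < Suc e * (k + 2)" using that(1) assms(1) by simp
    then have "j \<le> e" by (simp only: mult_less_cancel2 less_Suc_eq_le)
    then have "Q (1 + j)" using assms by (simp add: Q_def)
    moreover have "t = 1 + j + j * (k + 1)" using t by simp
    ultimately show ?thesis using Q_shift[of 1 j] by simp
  qed
  have run: "(move ^^ t) (?L 0) = ?L t" if "t \<le> e * (k + 2) + 2" for t
    using that stable perQ perR assms by (intro move_funpow_levels) auto
  have Q_end: "\<not> Q (e * (k + 2) + 2)"
  proof -
    have "\<not> Q (2 + e)" using assms(2) by (cases "e + 1 = k") (auto simp: Q_def)
    moreover have "e * (k + 2) + 2 = 2 + e + e * (k + 1)" by simp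
    ultimately show ?thesis using Q_shift[of 2 e] by simp
  qed
  have R_end: "R (e * (k + 2) + i) \<longleftrightarrow> R i" for i using R_shift[of i e] by (simp add: add.commute)
  have R_i: "\<not> R (2 + i)" if "i \<le> k" for i
    using that by (cases "i = k") (auto simp: R_def)
  have R_2: "\<not> R (e * (k + 2) + 2)" using R_i[of 0] R_end[of 2] by simp
  have nonaug: "\<not> augmented_marching_group (?L ?s)"
  proof (rule not_augmented)
    have "?L ?s 1 = k" using Q_end R_2 assms(1) by (simp add: levels_def)
    moreover have "R (?s + (k + 2))"
      unfolding perR using R_end[of 1] assms by (simp add: R_def)
    ultimately show "?L ?s (?L ?s 1 + 2) > 0" by (simp add: levels_def)
  qed
  \<comment> \<open>The single seed is now at place \<open>k + 1\<close>, where level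
    \<open>k + 1\<close> is empty; pointwise this already fits below
    \<open>marching_group (k + 1)\<close>, before the seed returns to the front.\<close>
  have aug: "augmented_marching_group (?L (Suc ?s))"
  proof (rule levels_augmented)
    have "Suc ?s = e * (k + 2) + 2" by simp
    then show "\<not> (Q (Suc ?s + (k + 1)) \<and> R (Suc ?s + (k + 1)))" "\<not> R (Suc ?s + (k + 2))"
      unfolding perQ perR using Q_end R_2 by metis+
    show "(True \<or> Q (Suc ?s + i)) \<and> \<not> R (Suc ?s + i)" if "i \<le> k" for i
      using R_end[of "2 + i"] R_i[OF that] by simp
  qed
  have start: "?L 0 = (\<lambda>i. if i = 0 then 0
      else Suc k - i + (of_bool (i \<le> e + 1) + of_bool (i \<le> 1) + of_bool (i \<le> 0)))"
  proof
    fix i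
    have "i \<le> k + 1 \<and> Q i \<longleftrightarrow> i \<le> e + 1" if "i \<noteq> 0"
      using that assms(2) by (cases "i = k + 1") (auto simp: Q_def)
    moreover have "i \<le> k + 2 \<and> R i \<longleftrightarrow> i \<le> 1" if "i \<noteq> 0"
      using that by (cases "i = k + 2") (auto simp: R_def)
    ultimately show "?L 0 i = (if i = 0 then 0
        else Suc k - i + (of_bool (i \<le> e + 1) + of_bool (i \<le> 1) + of_bool (i \<le> 0)))"
      by (auto simp: levels_def)
  qed
  have "T k + Suc ?s \<le> D (T k + (e + 1) + 1 + 0)"
    using nonaug aug by (intro depth_bound) (simp_all add: run flip: start del: funpow.simps)
  then show ?thesis by simp
qed

text \<open>With \<open>k = Suc j\<close>, level \<open>k\<close> has one gap and level
  \<open>k + 1\<close> has \<open>q\<close> seeds; the flag \<open>u\<close> adds one seed on level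
  \<open>k + 2\<close>. The case without \<open>u\<close> yields \<open>ell2\<close>, the case with
  \<open>u\<close> yields \<open>ell3\<close>.\<close>

lemma D_ge_gap:
  assumes "q \<ge> 1" "m \<ge> 1" "Suc j = q + m" "u \<Longrightarrow> q = m"
  shows "T j + m * Suc j \<le> D (T j + j + q + of_bool u)"
proof -
  define k where "k = Suc j"
  have k: "k \<ge> 2" "k = q + m" "j < k" using assms by (auto simp: k_def)
  define P where "P = (\<lambda>t. t mod k \<noteq> 0)"
  define Q where "Q = (\<lambda>t. t mod (k + 1) \<in> {1..q})"
  define R where "R = (\<lambda>t. u \<and> t mod (k + 2) = 1)"
  let ?L = "levels k P Q R" and ?s = "m * k - 1"
  have perP: "P (t + k) = P t" for t unfolding P_def by (simp only: mod_add_self2)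
  have perQ: "Q (t + (k + 1)) = Q t" for t unfolding Q_def by (simp only: mod_add_self2)
  have perR: "R (t + (k + 2)) = R t" for t unfolding R_def by (simp only: mod_add_self2)
  have Q_shift: "Q (x + l * (k + 1)) \<longleftrightarrow> Q x" for l x
    unfolding Q_def by (simp only: mod_mult_self1)
  have R_shift: "R (x + l * (k + 2)) \<longleftrightarrow> R x" for l x
    unfolding R_def by (simp only: mod_mult_self1)
  \<comment> \<open>The gap is at the front at the multiples of \<open>k\<close>. Modulo
    \<open>k + 1\<close>, \<open>l * k\<close> is \<open>k + 1 - l\<close>, which exceeds
    \<open>q\<close> exactly as long as \<open>l\<close> is at most \<open>m\<close>.\<close>
  have Q_hole: "\<not> Q (l * k)" if "1 \<le> l" "l \<le> m" for l
  proof -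
    obtain l' where l': "l = Suc l'" using \<open>1 \<le> l\<close> by (cases l) auto
    then have "l' \<le> k" using that k by simp
    then have "l * k = (k - l') + l' * (k + 1)" using l' by (simp add: algebra_simps)
    moreover have "q < k - l'" using that(2) k l' by linarith
    then have "\<not> Q (k - l')" by (simp add: Q_def)
    ultimately show ?thesis using Q_shift by metis
  qed
  have Q_P: "P t" if "1 \<le> t" "t \<le> m * k" "Q t" for t
  proof (rule ccontr)
    assume "\<not> P t"
    then obtain l where l: "t = l * k" by (metis P_def mod_eq_0_iff_dvd dvd_def mult.commute)
    then have "1 \<le> l" "l \<le> m" using that k by (auto simp: Suc_le_eq)
    with Q_hole l that show False by simp
  qed
  have R_Q: "Q t" if "t \<le> m * k" "R t" for t
  proof -
    define l where "l = t div (k + 2)"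
    have t: "t = 1 + l * (k + 2)"
      using that(2) div_mult_mod_eq[of t "k + 2"] by (simp add: R_def l_def)
    have "l * k < m * k"
      using that(1) unfolding t by (simp only: distrib_left add.assoc)
    then have "l < m" by (simp only: mult_less_cancel2)
    then have "Q (1 + l)" using assms(4) that(2) k by (simp add: Q_def R_def)
    moreover have "t = (1 + l) + l * (k + 1)" using t by simp
    ultimately show ?thesis using Q_shift by metis
  qed
  have run: "(move ^^ t) (?L 0) = ?L t" if "t \<le> m * k" for t
    using that R_Q Q_P perP perQ perR k by (intro move_funpow_levels) auto
  have mk: "m * k \<ge> 1" using assms k by simp
  then have s: "Suc ?s = m * k" by simp
  have Q_end: "\<not> Q (m * k)" using Q_hole assms by simp
  \<comment> \<open>For \<open>k = 2 * m\<close>, \<open>m * k\<close> is 2 modulo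
    \<open>k + 2\<close>, so the seed of \<open>R\<close> is at place \<open>k + 1\<close>, the one
    place left out here. Level \<open>k + 1\<close> is empty there, so both collisions happen at the
    same time.\<close>
  have R_end: "\<not> R (m * k + i)" if i: "i \<le> k \<or> i = k + 2" for i
  proof
    assume R: "R (m * k + i)"
    then have km: "k = 2 * m" using assms(4) k by (simp add: R_def)
    obtain m' where m': "m = Suc m'" using assms(2) by (cases m) auto
    have "m * k + i = (2 + i) + m' * (k + 2)" by (simp add: km m')
    with R R_shift have "R (2 + i)" by metis
    moreover consider "2 + i < k + 2" | "2 + i = k + 2" | "2 + i = 2 + (k + 2)"
      using i by linarith
    then have "(2 + i) mod (k + 2) \<noteq> 1"
    proof cases
      case 3
      then show ?thesis using k(1) by (simp only: mod_add_self2) simp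
    qed (use k(1) in auto)
    ultimately show False by (simp add: R_def)
  qed
  have nonaug: "\<not> augmented_marching_group (?L ?s)"
  proof (rule not_augmented)
    have "\<not> P (m * k)" by (simp add: P_def)
    then have L1: "?L ?s 1 = k - 1"
      using Q_end R_end[of 0] s by (simp add: levels_def)
    have "Q ?s"
    proof -
      obtain m' where m': "m = Suc m'" using assms(2) by (cases m) auto
      have "?s = q + m' * (k + 1)" using k m' by (simp add: algebra_simps)
      moreover have "Q q" using k assms by (simp add: Q_def)
      ultimately show ?thesis using Q_shift by metis
    qed
    then have "?L ?s (k + 1) > 0" using perQ[of ?s] by (simp add: levels_def)
    moreover have "?L ?s 1 + 2 = k + 1" using L1 k by simp
    ultimately show "?L ?s (?L ?s 1 + 2) > 0" by metis
  qed
  have aug: "augmented_marching_group (?L (m * k))"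
  proof (rule levels_augmented)
    show "\<not> (Q (m * k + (k + 1)) \<and> R (m * k + (k + 1)))" using Q_end perQ by blast
    show "\<not> R (m * k + (k + 2))" using R_end by blast
    \<comment> \<open>The gap is at place \<open>k\<close>, and there a seed of \<open>Q\<close>
      makes up for it.\<close>
    show "(P (m * k + i) \<or> Q (m * k + i)) \<and> \<not> R (m * k + i)" if "1 \<le> i" "i \<le> k" for i
    proof (cases "i = k")
      case True
      have "m * k + i = q + m * (k + 1)" using True k by simp
      moreover have "Q q" using k assms by (simp add: Q_def)
      ultimately have "Q (m * k + i)" using Q_shift by metis
      then show ?thesis using R_end that by blast
    next
      case False
      then show ?thesis using R_end that by (simp add: P_def)
    qed
  qed
  have start: "?L 0 = (\<lambda>i. if i = 0 then 0
      else Suc j - i + (of_bool (i \<le> j) + of_bool (i \<le> q) + of_bool (i \<le> of_bool u)))"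
  proof
    fix i
    have "i \<le> k \<and> P i \<longleftrightarrow> i \<le> j" if "i \<noteq> 0"
      using that by (cases "i = k") (auto simp: P_def k_def)
    moreover have "i \<le> k + 1 \<and> Q i \<longleftrightarrow> i \<le> q" if "i \<noteq> 0"
      using that k by (cases "i = k + 1") (auto simp: Q_def)
    moreover have "i \<le> k + 2 \<and> R i \<longleftrightarrow> i \<le> of_bool u" if "i \<noteq> 0"
      using that by (cases "i = k + 2") (auto simp: R_def)
    ultimately show "?L 0 i = (if i = 0 then 0
        else Suc j - i + (of_bool (i \<le> j) + of_bool (i \<le> q) + of_bool (i \<le> of_bool u)))"
      by (auto simp: levels_def k_def)
  qed
  have "T j + Suc ?s \<le> D (T j + j + q + of_bool u)"
  proof (rule depth_bound)
    show "q \<le> j" "of_bool u \<le> j" using assms by auto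
    show "\<not> augmented_marching_group ((move ^^ ?s) (\<lambda>i. if i = 0 then 0
        else Suc j - i + (of_bool (i \<le> j) + of_bool (i \<le> q) + of_bool (i \<le> of_bool u))))"
      unfolding start[symmetric] using nonaug by (simp add: run)
    show "augmented_marching_group ((move ^^ Suc ?s) (\<lambda>i. if i = 0 then 0
        else Suc j - i + (of_bool (i \<le> j) + of_bool (i \<le> q) + of_bool (i \<le> of_bool u))))"
      unfolding start[symmetric] s using aug by (simp add: run)
  qed
  then show ?thesis unfolding s by (simp add: k_def)
qed

section \<open>Evaluating the three bounds and comparing them with \<open>D\<close>\<close>

lemma ell1_eq:
  assumes "k \<ge> 1" "2 \<le> r" "r \<le> k + 1"
  shows "ell1 (T k + r) = int (T k) + (int r - 2) * (int k + 2) + 2"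
proof -
  have "k' = k \<and> r' = r" if "2 \<le> r'" "r' \<le> k' + 1" "T k + r = T k' + r'" for k' r'
  proof -
    \<comment> \<open>Here \<open>r\<close> may be \<open>k + 1\<close>, beyond the range of
      \<open>T_rep_unique\<close>; subtracting 1 on both sides repairs this.\<close>
    have eq: "T k + (r - 1) = T k' + (r' - 1)" using assms that by linarith
    show ?thesis using T_rep_unique[OF eq] assms that by simp linarith
  qed
  then show ?thesis using assms unfolding ell1_def by (subst if_P) (blast intro: the_equality)+
qed

lemma ell2_eq:
  assumes "k \<ge> 2" "r \<le> k - 2"
  shows "ell2 (T k + r) = int (T k) + int k * (int k - int r - 2)"
proof -
  have "k' = k \<and> r' = r" if "r' \<le> k' - 2" "T k + r = T k' + r'" for k' r'
  proof -
    have "r \<le> k" "r' \<le> k'" using assms that(1) by linarith+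
    then show ?thesis using T_rep_unique[OF that(2)] by simp
  qed
  then show ?thesis using assms unfolding ell2_def by (subst if_P) (blast intro: the_equality)+
qed

lemma ell3_eq:
  assumes "r \<ge> 1"
  shows "ell3 (T (2 * r) + r) = int (T (2 * r)) + 2 * int r * (int r - 1)"
proof -
  have "r' = r" if "T (2 * r) + r = T (2 * r') + r'" for r'
    using T_rep_unique[of "2 * r" r "2 * r'" r'] that by auto
  then show ?thesis using assms unfolding ell3_def by (subst if_P) (blast intro: the_equality)+
qed

lemma ell1_le_D: "ell1 n \<le> int (D n)"
proof (cases "\<exists>k r. k \<ge> 1 \<and> 2 \<le> r \<and> r \<le> k + 1 \<and> n = T k + r")
  case True
  then obtain k r where kr: "k \<ge> 1" "2 \<le> r" "r \<le> k + 1" "n = T k + r" by blast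
  then obtain e where e: "r = e + 2" by (metis add.commute le_Suc_ex)
  have "int (T k + e * (k + 2) + 2) \<le> int (D n)"
    using D_ge_high_seed[of k e] kr e by (simp only: of_nat_le_iff)
  then show ?thesis using ell1_eq[OF kr(1-3)] kr(4) e by (simp add: algebra_simps)
next
  case False
  then have "ell1 n = -1" unfolding ell1_def by (rule if_not_P)
  then show ?thesis by simp
qed

lemma ell2_le_D: "ell2 n \<le> int (D n)"
proof (cases "\<exists>k r. k \<ge> 2 \<and> r \<le> k - 2 \<and> n = T k + r")
  case True
  then obtain k r where kr: "k \<ge> 2" "r \<le> k - 2" "n = T k + r" by blast
  then obtain e where e: "k = r + e + 2"
    by (metis add.commute le_Suc_ex ordered_cancel_comm_monoid_diff_class.add_diff_inverse)
  \<comment> \<open>Here \<open>Suc j = k\<close>, \<open>q = r + 1\<close> and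
    \<open>m = k - r - 1\<close>. One of the \<open>m\<close> periods of length \<open>k\<close>
    turns \<open>T (k - 1)\<close> into \<open>T k\<close>.\<close>
  have "T (r + e + 1) + (e + 1) * Suc (r + e + 1) \<le> D (T (r + e + 1) + (r + e + 1) + (r + 1) + of_bool False)"
    by (rule D_ge_gap) simp_all
  then have "T k + e * k \<le> D n"
    using kr(3) by (simp add: e T_Suc algebra_simps)
  then have "int (T k + e * k) \<le> int (D n)" by (simp only: of_nat_le_iff)
  then show ?thesis using ell2_eq[OF kr(1,2)] kr(3) e by (simp add: algebra_simps)
next
  case False
  then have "ell2 n = -1" unfolding ell2_def by (rule if_not_P)
  then show ?thesis by simp
qed

lemma ell3_le_D: "ell3 n \<le> int (D n)"
proof (cases "\<exists>r. r \<ge> 1 \<and> n = T (2 * r) + r")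
  case True
  then obtain r where r: "r \<ge> 1" "n = T (2 * r) + r" by blast
  then obtain e where e: "r = Suc e" by (cases r) auto
  \<comment> \<open>Here \<open>Suc j = 2 * r\<close> and \<open>q = m = r\<close>, the balanced
    case demanded by \<open>u\<close>.\<close>
  have "T (2 * e + 1) + r * Suc (2 * e + 1) \<le> D (T (2 * e + 1) + (2 * e + 1) + r + of_bool True)"
    by (rule D_ge_gap) (simp_all add: e)
  then have "T (2 * r) + 2 * r * e \<le> D n"
    using r(2) by (simp add: e T_Suc algebra_simps)
  then have "int (T (2 * r) + 2 * r * e) \<le> int (D n)" by (simp only: of_nat_le_iff)
  then show ?thesis using ell3_eq[OF r(1)] r(2) e by (simp add: algebra_simps)
next
  case False
  then have "ell3 n = -1" unfolding ell3_def by (rule if_not_P)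
  then show ?thesis by simp
qed

theorem mainTheorem3:
  fixes n :: nat
  assumes "n \<ge> 1"
  shows "int (D n) \<ge> Max {ell1 n, ell2 n, ell3 n}"
  using ell1_le_D ell2_le_D ell3_le_D by simp

end
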